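(* There are absolute constants $K,k$ such that the following holds. Let $\mathcal M$ be any legitimate model of order $n$ of the class of Boolean circuits over $\bigcup_{a\ge 2}\{\neg,\vee_a,\wedge_a\}$ with $\overline\neg=\neg$, let $f\in\mathcal F_n$ and let $d\ge 8$. Then $$\rho_d(f,\mathcal M)\le Knd\left(2^{\lceil n/\lfloor d/8\rfloor\rceil}+1\right)+2^{Kn^{k/d}}+Kn^K .$$
   Context: $\mathcal F_n$ is the set of Boolean functions $\{0,1\}^n\to\{0,1\}$, identified with their sets of ones; $\oplus$ is symmetric difference. The circuit class consists of Boolean circuits with inputs $x_1,\dots,x_n$, constants, and gates labeled by negation or by AND/OR of any arity $a\ge 2$ (denoted $\wedge_a,\vee_a$); depth is the number of edges on the longest path from the output to an input or constant. A legitimate model of order $n$ is a set $\mathcal M$ with $\{0,1,x_1,\dots,x_n\}\subseteq\mathcal M\subseteq\mathcal F_n$ together with, for each connective $\circ$ of arity $a$, a commutative operation $\overline\circ:\mathcal M^a\to\mathcal M$; "$\overline\neg=\neg$" means $\mathcal M$ is closed under complement and $\overline\neg h=\neg h$. For a circuit $C$ the approximating circuit $\overline C\in\mathcal M$ is defined inductively: $\overline0=0,\overline1=1,\overline{x_i}=x_i$, and gate $\circ(C_1,\dots,C_a)$ becomes $\overline\circ(\overline{C_1},\dots,\overline{C_a})$. Error sets: $\delta_\circ(f_1,\dots,f_a):=\circ(f_1,\dots,f_a)\oplus\overline\circ(f_1,\dots,f_a)$ for $f_i\in\mathcal M$. The $d$-depth distance $\rho_d(f,\mathcal M)$ is the minimal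 $t$ such that there exist $g\in\mathcal M$ and $t$ tuples $(\circ_i,f^i_1,\dots,f^i_{a_i})$ ($\circ_i$ a connective of arity $a_i$, $f^i_j\in\mathcal M$) with $f\oplus g\subseteq\bigcup_{i=1}^t\delta_{\circ_i}(f^i_1,\dots,f^i_{a_i})$, where moreover each $f^i_j=\overline C$ for some circuit $C$ of the class of depth at most $d-1$, and $g=\overline D$ for some circuit $D$ of the class of depth at most $d$; if no such $t$ exists, $\rho_d(f,\mathcal M):=\infty$. *)

theory Defs
  imports Complex_Main "HOL-Library.Multiset" "HOL-Library.Extended_Real"
begin

text \<open>
  A point of the cube of dimension \<open>n\<close> is a Boolean list of length \<open>n\<close>, and a Boolean
  function is its set of ones. The order \<open>n\<close> is an ordinary natural number (not a type),
  so that constants can be chosen before it. The variables are numbered from \<open>0\<close>.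
\<close>

type_synonym bfun = "bool list set"

definition cube :: "nat \<Rightarrow> bool list set" where
  "cube n = {v. length v = n}"

definition boolean_functions :: "nat \<Rightarrow> bfun set" where
  "boolean_functions n = Pow (cube n)"

definition const_fun :: "nat \<Rightarrow> bool \<Rightarrow> bfun" where
  "const_fun n b = {v \<in> cube n. b}"

definition var_fun :: "nat \<Rightarrow> nat \<Rightarrow> bfun" where
  "var_fun n i = {v \<in> cube n. v ! i}"

datatype connective = Neg | And nat | Or nat

primrec arity :: "connective \<Rightarrow> nat" where
  "arity Neg = 1"
| "arity (And a) = a"
| "arity (Or a) = a"

definition connectives :: "connective set" where
  "connectives = {Neg} \<union> (\<Union>a\<in>{2..}. {And a, Or a})"

primrec truth :: "connective \<Rightarrow> bool list \<Rightarrow> bool" where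
  "truth Neg bs = (\<not> hd bs)"
| "truth (And a) bs = (\<forall>b\<in>set bs. b)"
| "truth (Or a) bs = (\<exists>b\<in>set bs. b)"

definition apply_conn :: "nat \<Rightarrow> connective \<Rightarrow> bfun list \<Rightarrow> bfun" where
  "apply_conn n c fs = {v \<in> cube n. truth c (map (\<lambda>f. v \<in> f) fs)}"

text \<open>
  Circuits are terms. Depth and the approximating circuit are determined by recursion on
  the inputs of a gate, so sharing of subcircuits is immaterial: a circuit given as an
  acyclic graph has the same depth and the same approximation as its unfolding.
\<close>

datatype circuit = Const bool | Var nat | Gate connective "circuit list"

inductive_set circuits :: "nat \<Rightarrow> circuit set" for n :: nat where
  Const: "Const b \<in> circuits n"
| Var: "i < n \<Longrightarrow> Var i \<in> circuits n"
| Gate: "c \<in> connectives \<Longrightarrow> length Cs = arity c \<Longrightarrow> \<forall>C\<in>set Cs. C \<in> circuits n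
    \<Longrightarrow> Gate c Cs \<in> circuits n"

primrec depth :: "circuit \<Rightarrow> nat" where
  "depth (Const b) = 0"
| "depth (Var i) = 0"
| "depth (Gate c Cs) = Suc (Max (set (map depth Cs)))"

text \<open>
  A model consists of its carrier \<open>M\<close> and of \<open>opn\<close>, where \<open>opn c\<close> is the operation
  approximating the connective \<open>c\<close>; only its values on lists over \<open>M\<close> of length
  \<open>arity c\<close>, for \<open>c\<close> in \<open>connectives\<close>, matter.
\<close>

definition tuples :: "bfun set \<Rightarrow> connective \<Rightarrow> bfun list set" where
  "tuples M c = {fs. set fs \<subseteq> M \<and> length fs = arity c}"

definition legitimate_model ::
    "nat \<Rightarrow> bfun set \<Rightarrow> (connective \<Rightarrow> bfun list \<Rightarrow> bfun) \<Rightarrow> bool" where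
  "legitimate_model n M opn \<longleftrightarrow>
     range (const_fun n) \<union> var_fun n ` {..<n} \<subseteq> M \<and>
     M \<subseteq> boolean_functions n \<and>
     (\<forall>c\<in>connectives. \<forall>fs\<in>tuples M c. opn c fs \<in> M) \<and>
     (\<forall>c\<in>connectives. \<forall>fs\<in>tuples M c. \<forall>gs\<in>tuples M c.
        mset fs = mset gs \<longrightarrow> opn c fs = opn c gs)"

definition exact_negation ::
    "nat \<Rightarrow> bfun set \<Rightarrow> (connective \<Rightarrow> bfun list \<Rightarrow> bfun) \<Rightarrow> bool" where
  "exact_negation n M opn \<longleftrightarrow>
     (\<forall>h\<in>M. cube n - h \<in> M \<and> opn Neg [h] = cube n - h)"

primrec approx :: "nat \<Rightarrow> (connective \<Rightarrow> bfun list \<Rightarrow> bfun) \<Rightarrow> circuit \<Rightarrow> bfun" where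
  "approx n opn (Const b) = const_fun n b"
| "approx n opn (Var i) = var_fun n i"
| "approx n opn (Gate c Cs) = opn c (map (approx n opn) Cs)"

definition error_set ::
    "nat \<Rightarrow> (connective \<Rightarrow> bfun list \<Rightarrow> bfun) \<Rightarrow> connective \<Rightarrow> bfun list \<Rightarrow> bool list set" where
  "error_set n opn c fs = sym_diff (apply_conn n c fs) (opn c fs)"

text \<open>
  In the following definition \<open>depth C + 1 \<le> d\<close> expresses depth at most \<open>d - 1\<close> without
  truncated subtraction.
\<close>

definition covered_by ::
    "nat \<Rightarrow> bfun set \<Rightarrow> (connective \<Rightarrow> bfun list \<Rightarrow> bfun) \<Rightarrow> nat \<Rightarrow> bfun \<Rightarrow> nat \<Rightarrow> bool" where
  "covered_by n M opn d f t \<longleftrightarrow>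
     (\<exists>g\<in>M. \<exists>ts :: (connective \<times> bfun list) list.
        length ts = t \<and>
        (\<exists>D\<in>circuits n. depth D \<le> d \<and> g = approx n opn D) \<and>
        (\<forall>(c, fs)\<in>set ts. c \<in> connectives \<and> fs \<in> tuples M c \<and>
           (\<forall>h\<in>set fs. \<exists>C\<in>circuits n. depth C + 1 \<le> d \<and> h = approx n opn C)) \<and>
        sym_diff f g \<subseteq> (\<Union>(c, fs)\<in>set ts. error_set n opn c fs))"

definition depth_distance ::
    "nat \<Rightarrow> bfun set \<Rightarrow> (connective \<Rightarrow> bfun list \<Rightarrow> bfun) \<Rightarrow> nat \<Rightarrow> bfun \<Rightarrow> enat" where
  "depth_distance n M opn d f =
     (if \<exists>t. covered_by n M opn d f t then enat (LEAST t. covered_by n M opn d f t) else \<infinity>)"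

end

theory Submission
  imports Defs "HOL-Probability.Probability_Mass_Function"
begin

text \<open>
  The idea is random self-reducibility. Split the variables into \<open>m = d div 8\<close> blocks and
  expand a function \<open>g\<close> into a tree that reads one block per level by an OR of ANDs. At a fixed
  point \<open>u\<close> only the nodes of one branch matter, and if \<open>g\<close> is uniformly random, then so is the
  function at every node of that branch. Let \<open>e j\<close> be the probability that an
  operation at the root of a random tree of height \<open>j + 1\<close> errs at \<open>u\<close>. If the sum of the \<open>e j\<close> is at
  least \<open>1/32\<close>, then \<open>O(n m)\<close> random roots cover \<open>u\<close>, and a union bound over the \<open>2 ^ n\<close> points
  gives one sample that covers all such \<open>u\<close>. Otherwise a random tree is
  correct at \<open>u\<close> with probability at least \<open>31/32\<close>, so \<open>f\<close>, written as the exclusive or of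
  the random functions \<open>g\<close> and \<open>f \<oplus> g\<close>, is computed correctly at \<open>u\<close> with
  probability at least \<open>15/16\<close>; an approximate majority of depth 3 and polynomial size then
  works for all remaining \<open>u\<close> at once. For \<open>d < 16\<close> the disjunctive normal form
  of \<open>f\<close> is enough.
\<close>

section \<open>Random functions and approximate majority\<close>

lemma prob_pmf_not:
  "measure_pmf.prob p {x. \<not> P x} = 1 - measure_pmf.prob p {x. P x}"
  using measure_pmf.prob_compl[of "{x. P x}" p] by (simp add: Compl_eq_Diff_UNIV[symmetric] Collect_neg_eq)

lemma prob_replicate_pmf_all:
  "measure_pmf.prob (replicate_pmf k p) {xs. \<forall>x\<in>set xs. P x} = measure_pmf.prob p {x. P x} ^ k"
proof (induction k)
  case (Suc k)
  let ?A = "{xs. \<forall>x\<in>set xs. P x}"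
  have "ennreal (measure_pmf.prob (replicate_pmf (Suc k) p) ?A) =
      (\<integral>\<^sup>+ x. emeasure (replicate_pmf k p) ((#) x -` ?A) \<partial>measure_pmf p)"
    by (simp add: measure_pmf.emeasure_eq_measure[symmetric] map_pmf_def[symmetric])
  also have "\<dots> = (\<integral>\<^sup>+ x. emeasure (replicate_pmf k p) ?A * indicator {x. P x} x \<partial>measure_pmf p)"
    by (intro nn_integral_cong) (auto simp: indicator_def vimage_def)
  also have "\<dots> = ennreal (measure_pmf.prob (replicate_pmf k p) ?A * measure_pmf.prob p {x. P x})"
    by (simp add: nn_integral_cmult_indicator measure_pmf.emeasure_eq_measure ennreal_mult)
  finally show ?case by (simp add: Suc.IH)
qed simp

lemma prob_replicate_pmf_ex:
  "measure_pmf.prob (replicate_pmf k p) {xs. \<exists>x\<in>set xs. P x} =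
     1 - (1 - measure_pmf.prob p {x. P x}) ^ k"
  using prob_pmf_not[of "replicate_pmf k p" "\<lambda>xs. \<forall>x\<in>set xs. \<not> P x"] prob_pmf_not[of p P]
  by (simp add: prob_replicate_pmf_all)

text \<open>Union bound: the bad events have total probability below 1, so they cannot exhaust the
  support.\<close>

lemma ex_avoiding_all_bad_events:
  assumes "finite U" and small: "\<And>u. u \<in> U \<Longrightarrow> measure_pmf.prob p {x. bad u x} \<le> e"
    and lt: "real (card U) * e < 1"
  shows "\<exists>x\<in>set_pmf p. \<forall>u\<in>U. \<not> bad u x"
proof -
  have "measure_pmf.prob p (\<Union>u\<in>U. {x. bad u x}) \<le> (\<Sum>u\<in>U. measure_pmf.prob p {x. bad u x})"
    using \<open>finite U\<close> by (intro measure_pmf.finite_measure_subadditive_finite) auto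
  also have "\<dots> \<le> real (card U) * e"
    using sum_bounded_above[of U "\<lambda>u. measure_pmf.prob p {x. bad u x}" e] small by simp
  finally have "measure_pmf.prob p (\<Union>u\<in>U. {x. bad u x}) < 1"
    using lt by simp
  hence "\<not> set_pmf p \<subseteq> (\<Union>u\<in>U. {x. bad u x})"
    by (metis AE_measure_pmf_iff in_mono less_irrefl measure_pmf.prob_eq_1 sets_measure_pmf UNIV_I)
  thus ?thesis by blast
qed


lemma prob_bind_pmf_of_set:
  assumes "finite A" "A \<noteq> {}"
  shows "measure_pmf.prob (bind_pmf (pmf_of_set A) q) X =
    (\<Sum>a\<in>A. measure_pmf.prob (q a) X) / real (card A)"
proof -
  have "ennreal (measure_pmf.prob (bind_pmf (pmf_of_set A) q) X) =
      (\<Sum>a\<in>A. ennreal (measure_pmf.prob (q a) X)) / ennreal (real (card A))"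
    using assms
    by (simp add: measure_pmf.emeasure_eq_measure[symmetric] nn_integral_pmf_of_set
        ennreal_of_nat_eq_real_of_nat)
  also have "\<dots> = ennreal ((\<Sum>a\<in>A. measure_pmf.prob (q a) X) / real (card A))"
    using assms by (simp add: sum_ennreal divide_ennreal sum_nonneg card_gt_0_iff)
  finally show ?thesis
    by (simp add: sum_nonneg)
qed

lemma map_fst_pmf_of_set_Times:
  assumes "finite A" "A \<noteq> {}" "finite B" "B \<noteq> {}"
  shows "map_pmf fst (pmf_of_set (A \<times> B)) = pmf_of_set A"
proof -
  have "pmf_of_set (A \<times> B) = pair_pmf (pmf_of_set A) (pmf_of_set B)"
  proof (rule pmf_eqI)
    fix x :: "'a \<times> 'b"
    show "pmf (pmf_of_set (A \<times> B)) x = pmf (pair_pmf (pmf_of_set A) (pmf_of_set B)) x"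
      using assms by (cases x) (simp add: pmf_pair indicator_def card_cartesian_product)
  qed
  thus ?thesis by (simp add: map_fst_pair_pmf)
qed

section \<open>Uniformly random Boolean functions\<close>

lemma finite_cube [simp]: "finite (cube n)"
  and card_cube: "card (cube n) = 2 ^ n"
  using finite_lists_length_eq[of "UNIV :: bool set" n] card_lists_length_eq[of "UNIV :: bool set" n]
  by (simp_all add: cube_def)

text \<open>This is the cofactor with the last variables fixed. Fixing variables from the end lets
  the others keep their indices.\<close>

definition restrict_suffix :: "bool list \<Rightarrow> bfun \<Rightarrow> bfun" where
  "restrict_suffix s g = {v. v @ s \<in> g}"

definition random_fun :: "nat \<Rightarrow> bfun pmf" where
  "random_fun n = pmf_of_set (Pow (cube n))"

text \<open>A function splits into two independent parts, its values on points ending in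
  \<open>s\<close> and its values elsewhere; the uniform distribution projects to the uniform one on
  the first part.\<close>

lemma map_restrict_suffix_random_fun:
  "map_pmf (restrict_suffix s) (random_fun (n + length s)) = random_fun n"
proof -
  define R where "R = cube (n + length s) - (\<lambda>v. v @ s) ` cube n"
  have "bij_betw (\<lambda>g. (restrict_suffix s g, g - (\<lambda>v. v @ s) ` cube n))
      (Pow (cube (n + length s))) (Pow (cube n) \<times> Pow R)"
    by (rule bij_betw_byWitness[where f' = "\<lambda>(h, r). (\<lambda>v. v @ s) ` h \<union> r"])
       (auto simp: restrict_suffix_def R_def cube_def subset_iff)
  from map_pmf_of_set_bij_betw[OF this]
  have eq: "map_pmf (\<lambda>g. (restrict_suffix s g, g - (\<lambda>v. v @ s) ` cube n)) (random_fun (n + length s)) =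
      pmf_of_set (Pow (cube n) \<times> Pow R)"
    unfolding random_fun_def by auto
  have "map_pmf (restrict_suffix s) (random_fun (n + length s)) =
      map_pmf fst (pmf_of_set (Pow (cube n) \<times> Pow R))"
    unfolding eq[symmetric] by (simp add: pmf.map_comp o_def)
  also have "\<dots> = random_fun n"
    unfolding random_fun_def by (rule map_fst_pmf_of_set_Times) (auto simp: R_def)
  finally show ?thesis .
qed

text \<open>Exclusive or with \<open>f\<close> is an involution on the functions, hence preserves
  the uniform distribution. This is the self-reduction: \<open>f\<close> becomes the exclusive or of
  two functions that are each uniform.\<close>

lemma map_sym_diff_random_fun:
  assumes "f \<subseteq> cube n"
  shows "map_pmf (sym_diff f) (random_fun n) = random_fun n"
  unfolding random_fun_def
  by (rule map_pmf_of_set_bij_betw, rule bij_betw_byWitness[where f' = "sym_diff f"])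
     (use assms in auto)

text \<open>
  Three alternations suffice: an AND of \<open>l\<close> values, with \<open>l\<close> about \<open>log\<^sub>2 n\<close>, makes false
  positives much rarer than true positives, an OR of \<open>4 ^ l\<close> of these pushes false negatives
  below \<open>exp (- 2 ^ l)\<close> and false positives below \<open>1/4\<close>, and an AND of \<open>n + 1\<close> of
  those pushes false positives below \<open>4 ^ - (n + 1)\<close>.
\<close>

lemma ex_approximate_majority:
  fixes p :: "'a pmf" and U :: "'b set"
  assumes fin: "finite U" and cU: "card U \<le> 2 ^ n"
    and err: "\<And>u. u \<in> U \<Longrightarrow> measure_pmf.prob p {x. V x u \<noteq> F u} \<le> 1 / 16"
    and l: "4 * (n + 1) \<le> 2 ^ l"
  shows "\<exists>X. length X = n + 1 \<and> (\<forall>Y\<in>set X. length Y = 4 ^ l \<and> (\<forall>Z\<in>set Y. length Z = l)) \<and>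
    (\<forall>u\<in>U. (\<forall>Y\<in>set X. \<exists>Z\<in>set Y. \<forall>x\<in>set Z. V x u) \<longleftrightarrow> F u)"
proof -
  define q where "q = replicate_pmf (n + 1) (replicate_pmf (4 ^ l) (replicate_pmf l p))"
  define acc where "acc X u \<longleftrightarrow> (\<forall>Y\<in>set X. \<exists>Z\<in>set Y. \<forall>x\<in>set Z. V x u)" for X u
  \<comment> \<open>Chosen so that a union bound over at most \<open>2 ^ n\<close> points stays
    below 1.\<close>
  define e :: real where "e = (1 / 4) ^ (n + 1)"
  have prob_acc: "measure_pmf.prob q {X. acc X u} =
      (1 - (1 - measure_pmf.prob p {x. V x u} ^ l) ^ 4 ^ l) ^ (n + 1)" for u
    by (simp only: q_def acc_def prob_replicate_pmf_all prob_replicate_pmf_ex)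
  have bound: "measure_pmf.prob q {X. acc X u \<noteq> F u} \<le> e" if u: "u \<in> U" for u
  proof (cases "F u")
    case False
    define a where "a = measure_pmf.prob p {x. V x u}"
    have a: "0 \<le> a" "a \<le> 1 / 16" using err[OF u] False by (auto simp: a_def)
    \<comment> \<open>Each of the \<open>4 ^ l\<close> ANDs accepts with probability
      \<open>a ^ l\<close>, so their OR accepts with probability at most \<open>(4 * a) ^ l\<close>,
      where \<open>4 * a \<le> 1 / 4\<close>.\<close>
    have "1 - real (4 ^ l) * a ^ l \<le> (1 - a ^ l) ^ 4 ^ l"
      using Bernoulli_inequality[of "- (a ^ l)" "4 ^ l"] a by (simp add: power_le_one)
    moreover have "real (4 ^ l) * a ^ l \<le> 1 / 4"
    proof -
      have "real (4 ^ l) * a ^ l = (4 * a) ^ l" by (simp add: power_mult_distrib)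
      also have "\<dots> \<le> (1 / 4) ^ l" using a by (intro power_mono) auto
      also have "\<dots> \<le> (1 / 4) ^ 1" using l by (intro power_decreasing) (cases l; simp)+
      finally show ?thesis by simp
    qed
    moreover have "(1 - a ^ l) ^ 4 ^ l \<le> 1" using a by (intro power_le_one) (auto simp: power_le_one)
    ultimately have "(1 - (1 - a ^ l) ^ 4 ^ l) ^ (n + 1) \<le> e"
      unfolding e_def by (intro power_mono) auto
    thus ?thesis using prob_acc[of u] False by (simp add: a_def)
  next
    case True
    define a where "a = measure_pmf.prob p {x. V x u}"
    have a: "15 / 16 \<le> a" "a \<le> 1" using err[OF u] True prob_pmf_not[of p "\<lambda>x. V x u"] by (auto simp: a_def)
    define t where "t = (1 - a ^ l) ^ 4 ^ l"
    have t: "0 \<le> t" "t \<le> 1" unfolding t_def using a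
      by (auto intro!: power_le_one zero_le_power simp: power_le_one)
    \<comment> \<open>The expected number of accepting ANDs is \<open>(4 * a) ^ l\<close>. As
      \<open>4 * a \<ge> 2\<close>, it is at least \<open>4 * (n + 1)\<close>, and it becomes the
      exponent.\<close>
    have "t \<le> exp (- (a ^ l)) ^ 4 ^ l"
      unfolding t_def using a exp_ge_add_one_self[of "- (a ^ l)"]
      by (intro power_mono) (auto simp: power_le_one)
    also have "\<dots> = exp (- ((4 * a) ^ l))"
      by (simp add: exp_of_nat_mult[symmetric] power_mult_distrib)
    also have "\<dots> \<le> exp (- real (4 * (n + 1)))"
    proof -
      have "real (4 * (n + 1)) \<le> 2 ^ l" using l by (metis of_nat_le_iff of_nat_numeral of_nat_power)
      also have "\<dots> \<le> (4 * a) ^ l" using a by (intro power_mono) auto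
      finally show ?thesis by simp
    qed
    also have "\<dots> = exp (- 4) ^ (n + 1)"
      by (simp add: exp_of_nat_mult[symmetric] mult_exp_exp algebra_simps)
    also have "\<dots> \<le> (1 / 8) ^ (n + 1)"
    proof (intro power_mono)
      have "2 \<le> exp (1 :: real)" using exp_ge_add_one_self[of 1] by simp
      hence "2 ^ 4 \<le> exp (1 :: real) ^ 4" by (intro power_mono) auto
      hence "8 \<le> exp (4 :: real)" by (simp add: exp_of_nat_mult[symmetric])
      thus "exp (- 4) \<le> (1 / 8 :: real)" by (simp add: exp_minus field_simps)
    qed auto
    finally have t8: "t \<le> (1 / 8) ^ (n + 1)" .
    \<comment> \<open>Union bound over the \<open>n + 1\<close> ORs; the factor
      \<open>n + 1 \<le> 2 ^ (n + 1)\<close> is why \<open>t\<close> was bounded with base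
      \<open>1 / 8\<close> instead of \<open>1 / 4\<close>.\<close>
    have "1 - (1 - t) ^ (n + 1) \<le> real (n + 1) * t"
      using Bernoulli_inequality[of "- t" "n + 1"] t by simp
    also have "\<dots> \<le> 2 ^ (n + 1) * (1 / 8) ^ (n + 1)"
      using t8 t of_nat_less_two_power[of "n + 1", where ?'a = real] by (intro mult_mono) auto
    also have "\<dots> = e" by (simp add: e_def power_mult_distrib[symmetric])
    finally show ?thesis using prob_acc[of u] True prob_pmf_not[of q "\<lambda>X. acc X u"]
      by (simp add: a_def t_def)
  qed
  have lt: "real (card U) * e < 1"
  proof -
    have "real (card U) * e \<le> 2 ^ n * e"
      using of_nat_mono[OF cU, where ?'a = real] by (intro mult_right_mono) (auto simp: e_def)
    also have "\<dots> = (1 / 2) ^ n / 4" by (simp add: e_def power_mult_distrib[symmetric])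
    also have "\<dots> < 1" using power_le_one[of "1/2 :: real" n] by simp
    finally show ?thesis .
  qed
  have "\<exists>X\<in>set_pmf q. \<forall>u\<in>U. acc X u = F u"
    using ex_avoiding_all_bad_events[OF fin bound lt] by simp
  then obtain X where "X \<in> set_pmf q" "\<forall>u\<in>U. acc X u = F u"
    by blast
  thus ?thesis
    by (intro exI[of _ X]) (auto simp: q_def set_replicate_pmf acc_def in_lists_conv_set)
qed

section \<open>Trees of random functions\<close>

text \<open>Only gates have error sets, so only they can contribute to a cover.\<close>

primrec is_gate :: "circuit \<Rightarrow> bool" where
  "is_gate (Const b) \<longleftrightarrow> False"
| "is_gate (Var i) \<longleftrightarrow> False"
| "is_gate (Gate c Cs) \<longleftrightarrow> True"

text \<open>Tests a variable against \<open>\<beta>\<close>. From index \<open>n\<close> on the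
  variables are padding with value 0, so the test is a constant.\<close>

definition literal :: "nat \<Rightarrow> nat \<Rightarrow> bool \<Rightarrow> circuit" where
  "literal n i \<beta> = (if i < n then if \<beta> then Var i else Gate Neg [Var i] else Const (\<not> \<beta>))"

definition branch :: "nat \<Rightarrow> nat \<Rightarrow> circuit \<Rightarrow> bool list \<Rightarrow> circuit" where
  "branch n i C w =
     Gate (And (Suc (length w))) (C # map (\<lambda>k. literal n (i + k) (w ! k)) [0..<length w])"

definition words :: "nat \<Rightarrow> bool list list" where
  "words b = List.n_lists b [False, True]"

text \<open>
  The variables with index at least \<open>n\<close> are read as 0, so that the number of variables
  of a tree is a multiple of the block length \<open>b\<close>. The root reads the last block.
\<close>

primrec tree :: "nat \<Rightarrow> nat \<Rightarrow> nat \<Rightarrow> bfun \<Rightarrow> circuit" where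
  "tree n b 0 g = Const ([] \<in> g)"
| "tree n b (Suc j) g =
     Gate (Or (2 ^ b)) (map (\<lambda>w. branch n (j * b) (tree n b j (restrict_suffix w g)) w) (words b))"

text \<open>The gates at which the root level can err. Negations in literals are exact, and deeper
  levels are accounted for as roots of smaller trees, so one root costs only
  \<open>2 ^ b + 1\<close> tuples.\<close>

definition root_gates :: "nat \<Rightarrow> nat \<Rightarrow> nat \<Rightarrow> bfun \<Rightarrow> circuit list" where
  "root_gates n b j g = tree n b (Suc j) g #
     map (\<lambda>w. branch n (j * b) (tree n b j (restrict_suffix w g)) w) (words b)"

lemma set_words: "set (words b) = cube b"
  by (auto simp: words_def set_n_lists cube_def)

lemma length_words: "length (words b) = 2 ^ b"
  by (simp add: words_def length_n_lists numeral_2_eq_2)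

lemma literal_circuit: "literal n i \<beta> \<in> circuits n"
  by (auto simp: literal_def connectives_def intro!: circuits.intros)

lemma depth_literal: "depth (literal n i \<beta>) \<le> 1"
  by (simp add: literal_def)

lemma branch_circuit: "C \<in> circuits n \<Longrightarrow> w \<noteq> [] \<Longrightarrow> branch n i C w \<in> circuits n"
  unfolding branch_def
  by (rule circuits.Gate) (auto simp: connectives_def literal_circuit Suc_le_eq)

lemma depth_Gate_le:
  "Cs \<noteq> [] \<Longrightarrow> (\<And>C. C \<in> set Cs \<Longrightarrow> depth C \<le> d) \<Longrightarrow> depth (Gate c Cs) \<le> Suc d"
  by (simp add: Max_le_iff)

lemma depth_branch: "depth (branch n i C w) \<le> Suc (max 1 (depth C))"
  unfolding branch_def
  by (rule depth_Gate_le) (auto intro: le_trans[OF depth_literal])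

lemma tree_circuit: "b \<ge> 1 \<Longrightarrow> tree n b j g \<in> circuits n"
proof (induction j arbitrary: g)
  case (Suc j)
  have "2 ^ 1 \<le> (2 :: nat) ^ b" using Suc.prems by (intro power_increasing) auto
  thus ?case
    using Suc unfolding tree.simps
    by (intro circuits.Gate)
       (auto simp: connectives_def length_words set_words cube_def intro!: branch_circuit)
qed (auto intro: circuits.Const)

text \<open>A level costs one OR and one AND; the extra 1 is for negated literals in the lowest
  block.\<close>

lemma depth_tree: "depth (tree n b j g) \<le> 2 * j + 1"
proof (induction j arbitrary: g)
  case (Suc j)
  have "words b \<noteq> []" using length_words[of b] by auto
  moreover have "depth (branch n (j * b) (tree n b j (restrict_suffix w g)) w) \<le> 2 * j + 2" for w
    using depth_branch[of n "j * b" "tree n b j (restrict_suffix w g)" w] Suc[of "restrict_suffix w g"]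
    by simp
  ultimately have "depth (tree n b (Suc j) g) \<le> Suc (2 * j + 2)"
    unfolding tree.simps by (intro depth_Gate_le) auto
  thus ?case by simp
qed simp

lemma root_gates_circuits:
  assumes "b \<ge> 1" "C \<in> set (root_gates n b j g)"
  shows "C \<in> circuits n" "depth C \<le> 2 * j + 3" "is_gate C"
proof -
  have "depth (branch n (j * b) (tree n b j h) w) \<le> 2 * j + 3" for h w
    using depth_branch[of n "j * b" "tree n b j h" w] depth_tree[of n b j h] by simp
  moreover have "depth (tree n b (Suc j) g) \<le> 2 * j + 3"
    using depth_tree[of n b "Suc j" g] by simp
  ultimately show "depth C \<le> 2 * j + 3"
    using assms by (auto simp: root_gates_def simp del: tree.simps)
  show "C \<in> circuits n"
    using assms tree_circuit[of b n "Suc j" g]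
    by (auto simp: root_gates_def set_words cube_def simp del: tree.simps
        intro!: branch_circuit tree_circuit)
  show "is_gate C" using assms by (auto simp: root_gates_def branch_def)
qed

lemma length_root_gates: "length (root_gates n b j g) = 2 ^ b + 1"
  by (simp add: root_gates_def length_words)

lemma restrict_suffix_append:
  "restrict_suffix w (restrict_suffix s g) = restrict_suffix (w @ s) g"
  by (simp add: restrict_suffix_def)

section \<open>Soundness of gates at a point, and covers\<close>

locale neg_model =
  fixes n :: nat and M :: "bfun set" and opn :: "connective \<Rightarrow> bfun list \<Rightarrow> bfun"
  assumes legitimate: "legitimate_model n M opn" and exact: "exact_negation n M opn"
begin

abbreviation ap :: "circuit \<Rightarrow> bfun" where
  "ap \<equiv> approx n opn"

text \<open>Concerns the top gate only, applied to the approximations of its inputs: a point of the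
  cube satisfies it iff it avoids the error set of that gate.\<close>

fun sound_at :: "bool list \<Rightarrow> circuit \<Rightarrow> bool" where
  "sound_at u (Gate c Cs) \<longleftrightarrow> (u \<in> ap (Gate c Cs) \<longleftrightarrow> truth c (map (\<lambda>C. u \<in> ap C) Cs))"
| "sound_at u _ \<longleftrightarrow> True"

lemma opn_in_model: "c \<in> connectives \<Longrightarrow> fs \<in> tuples M c \<Longrightarrow> opn c fs \<in> M"
  using legitimate unfolding legitimate_model_def by blast

lemma model_subset_cube: "h \<in> M \<Longrightarrow> h \<subseteq> cube n"
  using legitimate unfolding legitimate_model_def boolean_functions_def by blast

lemma approx_in_model: "C \<in> circuits n \<Longrightarrow> ap C \<in> M"
proof (induction rule: circuits.induct)
  case (Gate c Cs)
  hence "map ap Cs \<in> tuples M c" by (auto simp: tuples_def)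
  thus ?case using Gate(1) by (simp add: opn_in_model)
qed (use legitimate in \<open>auto simp: legitimate_model_def\<close>)

lemma approx_Neg: "C \<in> circuits n \<Longrightarrow> ap (Gate Neg [C]) = cube n - ap C"
  using exact approx_in_model[of C] by (simp add: exact_negation_def)

text \<open>By contraposition, a point where \<open>ap D\<close> and \<open>f\<close> differ lies in
  the error set of a listed gate. Inputs of a gate of depth at most \<open>d\<close> have depth at
  most \<open>d - 1\<close>, as the tuples require.\<close>

lemma covered_byI:
  assumes D: "D \<in> circuits n" "depth D \<le> d" and f: "f \<in> boolean_functions n"
    and Gs: "\<And>C. C \<in> set Gs \<Longrightarrow> C \<in> circuits n \<and> depth C \<le> d \<and> is_gate C"
    and correct: "\<And>u. u \<in> cube n \<Longrightarrow> \<forall>C\<in>set Gs. sound_at u C \<Longrightarrow> u \<in> ap D \<longleftrightarrow> u \<in> f"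
  shows "covered_by n M opn d f (length Gs)"
proof -
  \<comment> \<open>The default is never reached, since every member of \<open>Gs\<close> is a
    gate.\<close>
  define tup where "tup C = (case C of Gate c Cs \<Rightarrow> (c, map ap Cs) | _ \<Rightarrow> undefined)" for C
  have tuples: "c \<in> connectives \<and> fs \<in> tuples M c \<and>
      (\<forall>h\<in>set fs. \<exists>C\<in>circuits n. depth C + 1 \<le> d \<and> h = ap C)"
    if "(c, fs) \<in> set (map tup Gs)" for c fs
  proof -
    from that obtain C where "C \<in> set Gs" "tup C = (c, fs)" by auto
    with Gs[of C] obtain Cs where C: "Gate c Cs \<in> circuits n" "depth (Gate c Cs) \<le> d" "fs = map ap Cs"
      by (cases C) (auto simp: tup_def)
    from C(1) have *: "c \<in> connectives" "length Cs = arity c" "\<forall>C\<in>set Cs. C \<in> circuits n"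
      by (auto elim: circuits.cases)
    moreover have "depth C' + 1 \<le> d" if "C' \<in> set Cs" for C'
    proof -
      have "depth C' \<le> Max (depth ` set Cs)" using that by (intro Max_ge) auto
      thus ?thesis using C(2) by simp
    qed
    ultimately show ?thesis using C(3) by (auto simp: tuples_def approx_in_model)
  qed
  have cover: "sym_diff f (ap D) \<subseteq> (\<Union>(c, fs)\<in>set (map tup Gs). error_set n opn c fs)"
  proof
    fix u assume u: "u \<in> sym_diff f (ap D)"
    have "ap D \<subseteq> cube n"
      using approx_in_model[OF D(1)] by (rule model_subset_cube)
    with u f have "u \<in> cube n" by (auto simp: boolean_functions_def)
    with correct[OF this] u obtain C where "C \<in> set Gs" "\<not> sound_at u C" by blast
    with \<open>u \<in> cube n\<close> show "u \<in> (\<Union>(c, fs)\<in>set (map tup Gs). error_set n opn c fs)"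
      by (cases C) (force simp: tup_def error_set_def apply_conn_def o_def)+
  qed
  show ?thesis
    unfolding covered_by_def
  proof (intro bexI[of _ "ap D"] exI[of _ "map tup Gs"] conjI)
    show "\<exists>D'\<in>circuits n. depth D' \<le> d \<and> ap D = ap D'" using D by blast
    show "\<forall>(c, fs)\<in>set (map tup Gs). c \<in> connectives \<and> fs \<in> tuples M c \<and>
        (\<forall>h\<in>set fs. \<exists>C\<in>circuits n. depth C + 1 \<le> d \<and> h = ap C)"
      using tuples by blast
  qed (use cover approx_in_model[OF D(1)] in simp_all)
qed

lemma covered_by_imp_le: "covered_by n M opn d f t \<Longrightarrow> depth_distance n M opn d f \<le> enat t"
  by (auto simp: depth_distance_def intro: Least_le)

lemma approx_literal:
  assumes "u \<in> cube n" "i < n + k"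
  shows "u \<in> ap (literal n i \<beta>) \<longleftrightarrow> (u @ replicate k False) ! i = \<beta>"
proof -
  have "ap (Gate Neg [Var i]) = cube n - var_fun n i" if "i < n"
    using approx_Neg[OF circuits.Var[OF that]] by simp
  thus ?thesis
    using assms by (auto simp: literal_def var_fun_def const_fun_def cube_def nth_append)
qed

section \<open>Random trees at a fixed point\<close>

definition unsound_root :: "nat \<Rightarrow> nat \<Rightarrow> bool list \<Rightarrow> bfun \<Rightarrow> bool" where
  "unsound_root b j u g \<longleftrightarrow> (\<exists>C\<in>set (root_gates n b j g). \<not> sound_at u C)"

text \<open>When the root gates are sound, only the AND whose word is the current block of
  \<open>y\<close> can accept, and it returns the value of its subtree. Errors in the other subtrees
  are harmless.\<close>

lemma approx_tree_Suc:
  assumes u: "u \<in> cube n" and y: "y = u @ replicate k False" and len: "Suc j * b \<le> n + k"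
    and sound: "\<not> unsound_root b j u g"
  shows "u \<in> ap (tree n b (Suc j) g) \<longleftrightarrow>
    u \<in> ap (tree n b j (restrict_suffix (take b (drop (j * b) y)) g))"
proof -
  let ?B = "\<lambda>w. branch n (j * b) (tree n b j (restrict_suffix w g)) w"
  have ly: "length y = n + k" using u y by (simp add: cube_def)
  have B: "u \<in> ap (?B w) \<longleftrightarrow> w = take b (drop (j * b) y) \<and> u \<in> ap (tree n b j (restrict_suffix w g))"
    if w: "length w = b" for w
  proof -
    have "sound_at u (?B w)"
      using sound w by (auto simp: unsound_root_def root_gates_def set_words cube_def)
    hence "u \<in> ap (?B w) \<longleftrightarrow> u \<in> ap (tree n b j (restrict_suffix w g)) \<and>
        (\<forall>i<b. u \<in> ap (literal n (j * b + i) (w ! i)))"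
      unfolding branch_def by (auto simp: w)
    also have "(\<forall>i<b. u \<in> ap (literal n (j * b + i) (w ! i))) \<longleftrightarrow> (\<forall>i<b. y ! (j * b + i) = w ! i)"
      using len by (auto simp: approx_literal[OF u, of _ k] y)
    also have "\<dots> \<longleftrightarrow> w = take b (drop (j * b) y)"
      using w len ly by (auto simp: list_eq_iff_nth_eq)
    finally show ?thesis by blast
  qed
  have "sound_at u (tree n b (Suc j) g)"
    using sound by (auto simp: unsound_root_def root_gates_def)
  hence "u \<in> ap (tree n b (Suc j) g) \<longleftrightarrow> (\<exists>w\<in>cube b. u \<in> ap (?B w))"
    by (auto simp: set_words)
  also have "\<dots> \<longleftrightarrow> u \<in> ap (tree n b j (restrict_suffix (take b (drop (j * b) y)) g))"
    using B len ly by (auto simp: cube_def)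
  finally show ?thesis .
qed

lemma approx_tree:
  assumes u: "u \<in> cube n" and y: "y = u @ replicate k False" and len: "m * b = n + k"
    and sound: "\<And>j. j < m \<Longrightarrow> \<not> unsound_root b j u (restrict_suffix (drop (Suc j * b) y) g)"
  shows "u \<in> ap (tree n b m g) \<longleftrightarrow> y \<in> g"
proof -
  have ly: "length y = n + k" using u y by (simp add: cube_def)
  \<comment> \<open>Induction from the leaf upwards along the branch of \<open>y\<close>: the node
    at height \<open>j\<close> carries \<open>g\<close> with all variables from \<open>j * b\<close>
    on fixed as in \<open>y\<close>.\<close>
  have "j \<le> m \<Longrightarrow> u \<in> ap (tree n b j (restrict_suffix (drop (j * b) y) g)) \<longleftrightarrow> y \<in> g" for j
  proof (induction j)
    case 0
    thus ?case using u by (simp add: const_fun_def restrict_suffix_def)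
  next
    case (Suc j)
    have "Suc j * b \<le> m * b" using Suc.prems by (intro mult_le_mono1)
    hence "u \<in> ap (tree n b (Suc j) (restrict_suffix (drop (Suc j * b) y) g)) \<longleftrightarrow>
      u \<in> ap (tree n b j (restrict_suffix (take b (drop (j * b) y)) (restrict_suffix (drop (Suc j * b) y) g)))"
      using Suc.prems by (intro approx_tree_Suc[OF u y _ sound]) (auto simp: len)
    also have "take b (drop (j * b) y) @ drop (Suc j * b) y = drop (j * b) y"
      using append_take_drop_id[of b "drop (j * b) y"] by (simp add: add.commute)
    hence "restrict_suffix (take b (drop (j * b) y)) (restrict_suffix (drop (Suc j * b) y) g) =
        restrict_suffix (drop (j * b) y) g"
      by (simp only: restrict_suffix_append)
    finally show ?case using Suc by simp
  qed
  from this[of m] show ?thesis using len ly by (simp add: restrict_suffix_def)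
qed

text \<open>These are the numbers \<open>e j\<close> of the idea above; a tree of height
  \<open>Suc j\<close> reads \<open>Suc j * b\<close> variables.\<close>

definition failure :: "nat \<Rightarrow> nat \<Rightarrow> bool list \<Rightarrow> real" where
  "failure b j u = measure_pmf.prob (random_fun (Suc j * b)) {g. unsound_root b j u g}"

text \<open>Union bound over the nodes on the branch of \<open>y\<close>. Each carries a restriction
  of a uniform function, which is uniform again, so its error probability is
  \<open>failure b j u\<close>.\<close>

lemma prob_tree_wrong:
  assumes u: "u \<in> cube n" and y: "y = u @ replicate k False" and len: "m * b = n + k"
  shows "measure_pmf.prob (random_fun (n + k)) {g. (u \<in> ap (tree n b m g)) \<noteq> (y \<in> g)} \<le>
    (\<Sum>j<m. failure b j u)"
proof -
  have ly: "length y = n + k" using u y by (simp add: cube_def)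
  let ?E = "\<lambda>j. {g. unsound_root b j u (restrict_suffix (drop (Suc j * b) y) g)}"
  have "measure_pmf.prob (random_fun (n + k)) {g. (u \<in> ap (tree n b m g)) \<noteq> (y \<in> g)} \<le>
      measure_pmf.prob (random_fun (n + k)) (\<Union>j<m. ?E j)"
    using approx_tree[OF u y len] by (intro measure_pmf.finite_measure_mono) auto
  also have "\<dots> \<le> (\<Sum>j<m. measure_pmf.prob (random_fun (n + k)) (?E j))"
    by (intro measure_pmf.finite_measure_subadditive_finite) auto
  also have "\<dots> = (\<Sum>j<m. failure b j u)"
  proof (intro sum.cong refl)
    fix j assume "j \<in> {..<m}"
    hence "Suc j * b \<le> m * b" by (intro mult_le_mono1) auto
    hence "n + k = Suc j * b + length (drop (Suc j * b) y)" using ly len by simp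
    from map_restrict_suffix_random_fun[of "drop (Suc j * b) y" "Suc j * b", folded this]
    show "measure_pmf.prob (random_fun (n + k)) (?E j) = failure b j u"
      unfolding failure_def by (metis measure_map_pmf vimage_Collect_eq)
  qed
  finally show ?thesis .
qed

end

section \<open>Exclusive or and majority circuits\<close>

definition big_and :: "('a \<Rightarrow> circuit) \<Rightarrow> 'a list \<Rightarrow> circuit" where
  "big_and F xs = Gate (And (length xs)) (map F xs)"

definition big_or :: "('a \<Rightarrow> circuit) \<Rightarrow> 'a list \<Rightarrow> circuit" where
  "big_or F xs = Gate (Or (length xs)) (map F xs)"

lemma big_circuits:
  assumes "length xs \<ge> 2" "\<And>x. x \<in> set xs \<Longrightarrow> F x \<in> circuits n \<and> depth (F x) \<le> d"
  shows "big_and F xs \<in> circuits n \<and> depth (big_and F xs) \<le> Suc d"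
    "big_or F xs \<in> circuits n \<and> depth (big_or F xs) \<le> Suc d"
proof -
  from assms(1) have "map F xs \<noteq> []" by auto
  with assms show "big_and F xs \<in> circuits n \<and> depth (big_and F xs) \<le> Suc d"
    "big_or F xs \<in> circuits n \<and> depth (big_or F xs) \<le> Suc d"
    unfolding big_and_def big_or_def
    by (auto intro!: circuits.Gate depth_Gate_le simp: connectives_def simp del: depth.simps)
qed

definition xor_circuit :: "circuit \<Rightarrow> circuit \<Rightarrow> circuit" where
  "xor_circuit A B =
     Gate (Or 2) [Gate (And 2) [A, Gate Neg [B]], Gate (And 2) [Gate Neg [A], B]]"

text \<open>The two negations are exact and hence left out.\<close>

definition xor_gates :: "circuit \<Rightarrow> circuit \<Rightarrow> circuit list" where
  "xor_gates A B =
     [xor_circuit A B, Gate (And 2) [A, Gate Neg [B]], Gate (And 2) [Gate Neg [A], B]]"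

lemma xor_gates_circuits:
  assumes "A \<in> circuits n" "B \<in> circuits n" "depth A \<le> d" "depth B \<le> d" "C \<in> set (xor_gates A B)"
  shows "C \<in> circuits n \<and> depth C \<le> d + 3 \<and> is_gate C"
  using assms
  by (auto simp: xor_gates_def xor_circuit_def connectives_def intro!: circuits.Gate)

definition majority_circuit :: "('a \<Rightarrow> circuit) \<Rightarrow> 'a list list list \<Rightarrow> circuit" where
  "majority_circuit F X = big_and (big_or (big_and F)) X"

definition majority_gates :: "('a \<Rightarrow> circuit) \<Rightarrow> 'a list list list \<Rightarrow> circuit list" where
  "majority_gates F X = majority_circuit F X # map (big_or (big_and F)) X @ map (big_and F) (concat X)"

lemma length_concat_uniform: "(\<And>x. x \<in> set X \<Longrightarrow> length x = s) \<Longrightarrow> length (concat X) = length X * s"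
  by (induction X) auto

context neg_model
begin

lemma approx_xor:
  assumes "A \<in> circuits n" "B \<in> circuits n" "u \<in> cube n" "\<forall>C\<in>set (xor_gates A B). sound_at u C"
  shows "u \<in> ap (xor_circuit A B) \<longleftrightarrow> (u \<in> ap A) \<noteq> (u \<in> ap B)"
proof -
  have "u \<in> ap (Gate Neg [C]) \<longleftrightarrow> u \<notin> ap C" if "C \<in> circuits n" for C
    using approx_Neg[OF that] assms(3) by simp
  from this[OF assms(1)] this[OF assms(2)] show ?thesis
    using assms(4) by (auto simp: xor_gates_def xor_circuit_def)
qed

lemma approx_big_and: "sound_at u (big_and F xs) \<Longrightarrow> u \<in> ap (big_and F xs) \<longleftrightarrow> (\<forall>x\<in>set xs. u \<in> ap (F x))"
  and approx_big_or: "sound_at u (big_or F xs) \<Longrightarrow> u \<in> ap (big_or F xs) \<longleftrightarrow> (\<exists>x\<in>set xs. u \<in> ap (F x))"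
  by (simp_all add: big_and_def big_or_def)

lemma approx_majority:
  assumes "\<forall>C\<in>set (majority_gates F X). sound_at u C"
  shows "u \<in> ap (majority_circuit F X) \<longleftrightarrow> (\<forall>Y\<in>set X. \<exists>Z\<in>set Y. \<forall>x\<in>set Z. u \<in> ap (F x))"
proof -
  have "sound_at u (majority_circuit F X)" "\<forall>Y\<in>set X. sound_at u (big_or (big_and F) Y)"
    "\<forall>Y\<in>set X. \<forall>Z\<in>set Y. sound_at u (big_and F Z)"
    using assms by (auto simp: majority_gates_def)
  thus ?thesis by (simp add: majority_circuit_def approx_big_and approx_big_or)
qed

section \<open>Covers from random trees\<close>

lemma ex_hitting_roots:
  assumes n: "n \<ge> 1" and m: "m \<ge> 1"
  obtains S where "length S = 64 * n * m" "\<And>j g. (j, g) \<in> set S \<Longrightarrow> j < m"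
    "\<And>u. u \<in> cube n \<Longrightarrow> (\<Sum>j<m. failure b j u) \<ge> 1 / 32 \<Longrightarrow> \<exists>(j, g)\<in>set S. unsound_root b j u g"
proof -
  \<comment> \<open>A sample is a uniform level with a uniform function for it. At a point of
    \<open>U\<close> it errs with probability at least \<open>1 / (32 * m)\<close>, the average of
    the failures over the levels.\<close>
  define p where "p = bind_pmf (pmf_of_set {..<m}) (\<lambda>j. map_pmf (Pair j) (random_fun (Suc j * b)))"
  define q where "q = replicate_pmf (64 * n * m) p"
  define U where "U = {u \<in> cube n. (\<Sum>j<m. failure b j u) \<ge> 1 / 32}"
  have set_p: "set_pmf p \<subseteq> {..<m} \<times> UNIV" using m by (auto simp: p_def lessThan_empty_iff)
  have prob_p: "measure_pmf.prob p {x. unsound_root b (fst x) u (snd x)} = (\<Sum>j<m. failure b j u) / real m"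
    for u unfolding p_def using m
    by (subst prob_bind_pmf_of_set) (auto simp: failure_def vimage_def lessThan_empty_iff)
  have bound: "measure_pmf.prob q {xs. \<forall>x\<in>set xs. \<not> unsound_root b (fst x) u (snd x)} \<le> (1 / 4) ^ n"
    if u: "u \<in> U" for u
  proof -
    define a where "a = measure_pmf.prob p {x. unsound_root b (fst x) u (snd x)}"
    have "1 / 32 / real m \<le> (\<Sum>j<m. failure b j u) / real m"
      using u by (intro divide_right_mono) (auto simp: U_def)
    hence a: "a \<le> 1" "1 / 32 / real m \<le> a"
      by (simp_all add: a_def flip: prob_p)
    have "2 \<le> exp (1 :: real)" using exp_ge_add_one_self[of 1] by simp
    hence "2 ^ 2 \<le> exp (1 :: real) ^ 2" by (intro power_mono) auto
    hence e: "exp (- 2 :: real) \<le> 1 / 4" by (simp add: exp_of_nat_mult[symmetric] exp_minus field_simps)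
    have "(1 - a) ^ (64 * n * m) \<le> exp (- a) ^ (64 * n * m)"
      using a exp_ge_add_one_self[of "- a"] by (intro power_mono) auto
    also have "\<dots> \<le> exp (- (1 / 32 / real m)) ^ (64 * n * m)"
      using a by (intro power_mono) auto
    \<comment> \<open>The sample size \<open>64 * n * m\<close> is made for this:
      \<open>64 * n * m / (32 * m) = 2 * n\<close>.\<close>
    also have "\<dots> = exp (- 2) ^ n"
      using m by (simp add: exp_of_nat_mult[symmetric] field_simps)
    also have "\<dots> \<le> (1 / 4) ^ n" using e by (intro power_mono) auto
    finally show ?thesis
      unfolding q_def prob_replicate_pmf_all prob_pmf_not a_def[symmetric] .
  qed
  have lt: "real (card U) * (1 / 4) ^ n < 1"
  proof -
    have "card U \<le> 2 ^ n" using card_mono[of "cube n" U] by (auto simp: U_def card_cube)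
    hence "real (card U) \<le> 2 ^ n" using of_nat_mono by fastforce
    hence "real (card U) * (1 / 4) ^ n \<le> 2 ^ n * (1 / 4) ^ n" by (intro mult_right_mono) auto
    also have "\<dots> = (1 / 2) ^ n" by (simp add: power_mult_distrib[symmetric])
    also have "\<dots> < 1" using n by (intro power_Suc_less_one power_less_one_iff[THEN iffD2]) auto
    finally show ?thesis .
  qed
  have "finite U" by (simp add: U_def)
  have "\<exists>S\<in>set_pmf q. \<forall>u\<in>U. \<exists>x\<in>set S. unsound_root b (fst x) u (snd x)"
    using ex_avoiding_all_bad_events[OF \<open>finite U\<close> bound lt] by simp
  then obtain S where S: "S \<in> set_pmf q"
      "\<forall>u\<in>U. \<exists>x\<in>set S. unsound_root b (fst x) u (snd x)"
    by blast
  show thesis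
  proof (rule that[of S])
    show "length S = 64 * n * m" using S(1) by (auto simp: q_def set_replicate_pmf)
    show "j < m" if "(j, g) \<in> set S" for j g
      using S(1) set_p that by (auto simp: q_def set_replicate_pmf in_lists_conv_set)
    show "\<exists>(j, g)\<in>set S. unsound_root b j u g"
      if "u \<in> cube n" "(\<Sum>j<m. failure b j u) \<ge> 1 / 32" for u
      using S(2) that by (auto simp: U_def case_prod_beta)
  qed
qed

text \<open>The depth is \<open>2 * m + 1\<close> for a tree, 3 for the exclusive or and 3 for the
  majority. In the bound, the first summand counts sampled roots, the second the exclusive or and
  majority gates.\<close>

lemma covered_by_random_trees:
  assumes n: "n \<ge> 1" and m: "m \<ge> 1" and b: "b \<ge> 1" and len: "m * b = n + k"
    and f: "f \<in> boolean_functions n" and d: "2 * m + 7 \<le> d"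
  obtains t where "covered_by n M opn d f t" "t \<le> 64 * n * m * (2 ^ b + 1) + 49152 * n ^ 4"
proof -
  obtain S where S: "length S = 64 * n * m" "\<And>j g. (j, g) \<in> set S \<Longrightarrow> j < m"
    "\<And>u. u \<in> cube n \<Longrightarrow> (\<Sum>j<m. failure b j u) \<ge> 1 / 32 \<Longrightarrow> \<exists>(j, g)\<in>set S. unsound_root b j u g"
    using ex_hitting_roots[OF n m] by blast
  define U where "U = {u \<in> cube n. (\<Sum>j<m. failure b j u) < 1 / 32}"
  have finU: "finite U" by (simp add: U_def)
  have cU: "card U \<le> 2 ^ n" using card_mono[of "cube n" U] by (auto simp: U_def card_cube)
  \<comment> \<open>Extends \<open>f\<close> to the padding variables by ignoring them.\<close>
  define f' where "f' = {y \<in> cube (n + k). take n y \<in> f}"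
  define A where "A = tree n b m"
  define B where "B g = tree n b m (sym_diff f' g)" for g
  define V where "V g u \<longleftrightarrow> (u \<in> ap (A g)) \<noteq> (u \<in> ap (B g))" for g u
  \<comment> \<open>Both \<open>g\<close> and \<open>sym_diff f' g\<close> are uniform, so each tree
    is wrong with probability at most \<open>1 / 32\<close>; a union bound needs no
    independence.\<close>
  have err: "measure_pmf.prob (random_fun (n + k)) {g. V g u \<noteq> (u \<in> f)} \<le> 1 / 16" if "u \<in> U" for u
  proof -
    from that have u: "u \<in> cube n" and fail: "(\<Sum>j<m. failure b j u) < 1 / 32" by (auto simp: U_def)
    define y where "y = u @ replicate k False"
    define W where "W = {g. (u \<in> ap (A g)) \<noteq> (y \<in> g)}"
    have W: "measure_pmf.prob (random_fun (n + k)) W \<le> 1 / 32"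
      unfolding W_def A_def using prob_tree_wrong[OF u y_def len] fail by linarith
    have vim: "sym_diff f' -` W = {g. (u \<in> ap (B g)) \<noteq> (y \<in> sym_diff f' g)}"
      by (auto simp: W_def A_def B_def)
    have same: "measure_pmf.prob (random_fun (n + k)) (sym_diff f' -` W) =
        measure_pmf.prob (random_fun (n + k)) W"
      using map_sym_diff_random_fun[of f' "n + k"] unfolding measure_map_pmf[symmetric]
      by (simp add: f'_def)
    have "u \<in> f \<longleftrightarrow> y \<in> f'" using u by (simp add: f'_def y_def cube_def)
    hence "{g. V g u \<noteq> (u \<in> f)} \<subseteq> W \<union> {g. (u \<in> ap (B g)) \<noteq> (y \<in> sym_diff f' g)}"
      by (auto simp: V_def W_def)
    hence "measure_pmf.prob (random_fun (n + k)) {g. V g u \<noteq> (u \<in> f)} \<le>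
        measure_pmf.prob (random_fun (n + k)) (W \<union> {g. (u \<in> ap (B g)) \<noteq> (y \<in> sym_diff f' g)})"
      by (intro measure_pmf.finite_measure_mono) auto
    also have "\<dots> \<le> measure_pmf.prob (random_fun (n + k)) W +
        measure_pmf.prob (random_fun (n + k)) {g. (u \<in> ap (B g)) \<noteq> (y \<in> sym_diff f' g)}"
      by (intro measure_Un_le) auto
    finally show ?thesis using W same unfolding vim by simp
  qed
  \<comment> \<open>The least suitable \<open>l\<close> is \<open>i + 1\<close>; minimality gives
    \<open>2 ^ l < 8 * (n + 1) \<le> 16 * n\<close>.\<close>
  obtain i where i: "2 ^ i < 4 * (n + 1)" "4 * (n + 1) \<le> 2 ^ (i + 1)"
    using ex_power_ivl2[of 2 "4 * (n + 1)"] by auto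
  define l where "l = i + 1"
  have l: "4 * (n + 1) \<le> 2 ^ l" "2 ^ l \<le> 16 * n" using i n by (auto simp: l_def)
  have "l < 2 ^ l" by simp
  have "l \<ge> 2"
  proof (rule ccontr)
    assume "\<not> l \<ge> 2"
    hence "(2 :: nat) ^ l \<le> 2 ^ 1" by (intro power_increasing) auto
    with l show False by simp
  qed
  have s2: "4 ^ l \<ge> (2 :: nat)" using l \<open>l \<ge> 2\<close> power_increasing[of 1 l "4 :: nat"] by simp
  have "\<exists>X. length X = n + 1 \<and> (\<forall>Y\<in>set X. length Y = 4 ^ l \<and> (\<forall>Z\<in>set Y. length Z = l)) \<and>
      (\<forall>u\<in>U. (\<forall>Y\<in>set X. \<exists>Z\<in>set Y. \<forall>g\<in>set Z. V g u) \<longleftrightarrow> u \<in> f)"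
    by (rule ex_approximate_majority[OF finU cU err l(1)])
  then obtain X where X: "length X = n + 1"
    "\<forall>Y\<in>set X. length Y = 4 ^ l \<and> (\<forall>Z\<in>set Y. length Z = l)"
    "\<forall>u\<in>U. (\<forall>Y\<in>set X. \<exists>Z\<in>set Y. \<forall>g\<in>set Z. V g u) \<longleftrightarrow> u \<in> f"
    by (elim exE conjE) (rule that)
  define F where "F g = xor_circuit (A g) (B g)" for g
  \<comment> \<open>Gates inside \<open>A g\<close> and \<open>B g\<close> need not be listed for
    their own sake: \<open>X\<close> was chosen for the values \<open>V\<close> that the
    approximations actually take, errors included.\<close>
  define Gs where "Gs = concat (map (\<lambda>(j, g). root_gates n b j g) S) @ majority_gates F X @
    concat (map (\<lambda>g. xor_gates (A g) (B g)) (concat (concat X)))"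
  have AB: "A g \<in> circuits n" "B g \<in> circuits n" "depth (A g) \<le> 2 * m + 1" "depth (B g) \<le> 2 * m + 1" for g
    using tree_circuit[OF b] depth_tree by (auto simp: A_def B_def)
  have xor_ok: "C \<in> circuits n \<and> depth C \<le> 2 * m + 4 \<and> is_gate C"
    if "C \<in> set (xor_gates (A g) (B g))" for C g
    using xor_gates_circuits[OF AB that] by simp
  have F_ok: "F g \<in> circuits n \<and> depth (F g) \<le> 2 * m + 4" for g
    using xor_ok[of "F g" g] by (auto simp: F_def xor_gates_def)
  have and_ok: "big_and F Z \<in> circuits n \<and> depth (big_and F Z) \<le> Suc (2 * m + 4)"
    if "Y \<in> set X" "Z \<in> set Y" for Y Z
    using X(2) that \<open>l \<ge> 2\<close> F_ok by (intro big_circuits(1)) auto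
  have or_ok: "big_or (big_and F) Y \<in> circuits n \<and> depth (big_or (big_and F) Y) \<le> Suc (Suc (2 * m + 4))"
    if "Y \<in> set X" for Y
    by (rule big_circuits(2)) (use X(2) that s2 and_ok[OF that] in auto)
  have maj_ok: "majority_circuit F X \<in> circuits n \<and>
      depth (majority_circuit F X) \<le> Suc (Suc (Suc (2 * m + 4)))"
    unfolding majority_circuit_def by (rule big_circuits(1)) (use X(1) n or_ok in auto)
  have "covered_by n M opn d f (length Gs)"
  proof (rule covered_byI[OF _ _ f])
    show "majority_circuit F X \<in> circuits n" "depth (majority_circuit F X) \<le> d"
      using maj_ok d by auto
    show "C \<in> circuits n \<and> depth C \<le> d \<and> is_gate C" if C: "C \<in> set Gs" for C
    proof -
      consider j g where "(j, g) \<in> set S" "C \<in> set (root_gates n b j g)" | "C \<in> set (majority_gates F X)"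
        | g where "C \<in> set (xor_gates (A g) (B g))"
        using C by (fastforce simp: Gs_def)
      thus ?thesis
      proof cases
        case 1
        thus ?thesis using root_gates_circuits[OF b 1(2)] S(2)[OF 1(1)] d by simp
      next
        case 2
        moreover have "is_gate C" using 2
          by (auto simp: majority_gates_def majority_circuit_def big_and_def big_or_def)
        ultimately show ?thesis using and_ok or_ok maj_ok d
          by (fastforce simp: majority_gates_def)
      next
        case 3
        thus ?thesis using xor_ok d by fastforce
      qed
    qed
    show "u \<in> ap (majority_circuit F X) \<longleftrightarrow> u \<in> f"
      if u: "u \<in> cube n" and sound: "\<forall>C\<in>set Gs. sound_at u C" for u
    proof -
      \<comment> \<open>Outside \<open>U\<close> some sampled root errs, so soundness of all of them
        puts \<open>u\<close> into \<open>U\<close>.\<close>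
      have "\<not> (\<exists>(j, g)\<in>set S. unsound_root b j u g)"
        using sound by (fastforce simp: Gs_def unsound_root_def)
      hence "u \<in> U" using S(3)[OF u] u by (force simp: U_def)
      have "\<forall>C\<in>set (majority_gates F X). sound_at u C" using sound by (simp add: Gs_def)
      from approx_majority[OF this]
      have "u \<in> ap (majority_circuit F X) \<longleftrightarrow> (\<forall>Y\<in>set X. \<exists>Z\<in>set Y. \<forall>g\<in>set Z. u \<in> ap (F g))" .
      also have "\<dots> \<longleftrightarrow> (\<forall>Y\<in>set X. \<exists>Z\<in>set Y. \<forall>g\<in>set Z. V g u)"
      proof (intro ball_cong bex_cong refl)
        fix Y Z g assume "Y \<in> set X" "Z \<in> set Y" "g \<in> set Z"
        hence "\<forall>C\<in>set (xor_gates (A g) (B g)). sound_at u C"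
          using sound by (auto simp: Gs_def)
        from approx_xor[OF AB(1,2) u this] show "u \<in> ap (F g) \<longleftrightarrow> V g u"
          by (simp add: F_def V_def)
      qed
      finally show ?thesis using X(3) \<open>u \<in> U\<close> by simp
    qed
  qed
  moreover have "length Gs \<le> 64 * n * m * (2 ^ b + 1) + 49152 * n ^ 4"
  proof -
    define N where "N = (n + 1) * 4 ^ l * l"
    have X2: "length (concat X) = (n + 1) * 4 ^ l"
      unfolding X(1)[symmetric] by (rule length_concat_uniform) (use X(2) in auto)
    have X3: "length (concat (concat X)) = N"
      unfolding N_def X2[symmetric] by (rule length_concat_uniform) (use X(2) in auto)
    have "length (concat (map (\<lambda>(j, g). root_gates n b j g) S)) =
        length (map (\<lambda>(j, g). root_gates n b j g) S) * (2 ^ b + 1)"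
      by (rule length_concat_uniform) (auto simp: length_root_gates)
    moreover have "length (concat (map (\<lambda>g. xor_gates (A g) (B g)) (concat (concat X)))) =
        length (map (\<lambda>g. xor_gates (A g) (B g)) (concat (concat X))) * 3"
      by (rule length_concat_uniform) (auto simp: xor_gates_def)
    moreover have "length (majority_gates F X) = 1 + (n + 1) + (n + 1) * 4 ^ l"
      using X(1) X2 by (simp add: majority_gates_def)
    ultimately have total: "length Gs = 64 * n * m * (2 ^ b + 1) + (1 + (n + 1) + (n + 1) * 4 ^ l + N * 3)"
      using S(1) X3 by (simp add: Gs_def)
    have N1: "(n + 1) * 4 ^ l \<le> N" using \<open>l \<ge> 2\<close> by (simp add: N_def)
    have N2: "n + 1 \<le> (n + 1) * 4 ^ l" using mult_le_mono2[of 1 "4 ^ l" "n + 1"] by simp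
    have N3: "N \<le> 8192 * n ^ 4"
    proof -
      have "4 ^ l = 2 ^ l * (2 ^ l :: nat)" by (simp flip: power_mult_distrib)
      also have "\<dots> \<le> (16 * n) * (16 * n)" by (intro mult_le_mono l(2))
      finally have "4 ^ l \<le> (16 * n) * (16 * n)" .
      moreover have "n + 1 \<le> 2 * n" "l \<le> 16 * n" using n l(2) \<open>l < 2 ^ l\<close> by linarith+
      ultimately have "N \<le> (2 * n) * ((16 * n) * (16 * n)) * (16 * n)"
        unfolding N_def by (intro mult_le_mono)
      also have "\<dots> = 8192 * n ^ 4" by (simp add: power4_eq_xxxx)
      finally show ?thesis .
    qed
    \<comment> \<open>The gates beyond the sampled roots number at most \<open>6 * N\<close>, and
      \<open>6 * 8192 = 49152\<close>.\<close>
    have "x \<le> a + 49152 * q"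
      if "x = a + (1 + (p + 1) + c + N * 3)" "c \<le> N" "p + 1 \<le> c" "N \<le> 8192 * q" for x a p c q :: nat
      using that by linarith
    from this[OF total N1 N2 N3] show ?thesis .
  qed
  ultimately show thesis by (rule that)
qed

text \<open>With a single block of length \<open>n\<close>, the tree of height 1 is the disjunctive
  normal form of \<open>f\<close>, and its root gates are all its gates except exact
  negations.\<close>

lemma covered_by_DNF:
  assumes n: "n \<ge> 1" and f: "f \<in> boolean_functions n" and d: "d \<ge> 3"
  shows "covered_by n M opn d f (2 ^ n + 1)"
  unfolding length_root_gates[of n n 0 f, symmetric]
proof (rule covered_byI[OF _ _ f])
  show "tree n n 1 f \<in> circuits n" "depth (tree n n 1 f) \<le> d"
    using n d tree_circuit[of n n 1 f] depth_tree[of n n 1 f] by auto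
  show "C \<in> circuits n \<and> depth C \<le> d \<and> is_gate C" if "C \<in> set (root_gates n n 0 f)" for C
    using root_gates_circuits[OF n that] d by simp
  show "u \<in> ap (tree n n 1 f) \<longleftrightarrow> u \<in> f"
    if u: "u \<in> cube n" and "\<forall>C\<in>set (root_gates n n 0 f). sound_at u C" for u
    using that by (intro approx_tree[where k = 0])
      (auto simp: unsound_root_def restrict_suffix_def cube_def)
qed

end

section \<open>Choice of blocks and constants\<close>

theorem theorem4:
  shows "\<exists>K k :: real. K > 0 \<and> k > 0 \<and>
    (\<forall>(n::nat) (M :: bfun set) (opn :: connective \<Rightarrow> bfun list \<Rightarrow> bfun) (f :: bfun) (d::nat).
       legitimate_model n M opn \<longrightarrow> exact_negation n M opn \<longrightarrow>
       f \<in> boolean_functions n \<longrightarrow> d \<ge> 8 \<longrightarrow>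
       ereal_of_enat (depth_distance n M opn d f) \<le>
         ereal (K * real n * real d *
                  (2 powr real_of_int \<lceil>real n / real_of_int \<lfloor>real d / 8\<rfloor>\<rceil> + 1)
                + 2 powr (K * real n powr (k / real d))
                + K * real n powr K))"
proof (rule exI[of _ 49152], rule exI[of _ 1], intro conjI allI impI)
  fix n M opn f and d :: nat
  assume legit: "legitimate_model n M opn" "exact_negation n M opn"
    and f: "f \<in> boolean_functions n" and d: "d \<ge> 8"
  interpret neg_model n M opn by unfold_locales (fact legit)+
  define m where "m = d div 8"
  define b where "b = nat \<lceil>real n / real m\<rceil>"
  have m: "m \<ge> 1" "8 * m \<le> d" using d by (auto simp: m_def)
  have floor_d: "\<lfloor>real d / 8\<rfloor> = int m"
    using floor_divide_of_nat_eq[of d 8, where ?'a = real] by (simp add: m_def)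
  have "\<lceil>real n / real m\<rceil> = int b"
    using less_le_trans[of "- 1" 0 "real n / real m"] by (simp add: b_def)
  hence exponent: "2 powr real_of_int \<lceil>real n / real_of_int \<lfloor>real d / 8\<rfloor>\<rceil> = 2 ^ b"
    by (simp add: floor_d powr_realpow)
  have "\<exists>t. covered_by n M opn d f t \<and> real t \<le> 49152 * real n * real d * (2 ^ b + 1) + 49152 * real n powr 49152"
  proof (cases "n = 0")
    case True
    \<comment> \<open>The cube has a single point, so \<open>f\<close> is a constant and an empty
      cover suffices.\<close>
    have "covered_by n M opn d f (length ([] :: circuit list))"
      by (rule covered_byI[OF circuits.Const[of "[] \<in> f"] _ f]) (auto simp: True cube_def const_fun_def)
    thus ?thesis by (intro exI[of _ 0]) auto
  next
    case False
    hence n: "n \<ge> 1" by simp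
    show ?thesis
    proof (cases "m = 1")
      \<comment> \<open>Here \<open>d < 16\<close>, and for \<open>d = 8\<close> the depth
        \<open>2 * m + 7 = 9\<close> would be too large; the normal form has depth at most 3, and
        \<open>b = n\<close>.\<close>
      case True
      hence "b = n" by (simp add: b_def)
      have "1 * 1 * real (2 ^ n + 1) \<le> 49152 * real n * real d * (2 ^ n + 1)"
        using n d by (intro mult_mono) auto
      hence "real (2 ^ n + 1) \<le> 49152 * real n * real d * (2 ^ n + 1) + 49152 * real n powr 49152"
        unfolding mult_1 by (intro add_increasing2) simp_all
      thus ?thesis using covered_by_DNF[OF n f, of d] d \<open>b = n\<close> by auto
    next
      case False
      \<comment> \<open>This yields the depth budget:
        \<open>2 * m + 7 \<le> 8 * m \<le> d\<close>.\<close>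
      hence "m \<ge> 2" using m by simp
      have "real n / real m \<le> real b" unfolding b_def by linarith
      hence "real n \<le> real m * real b" using m by (simp add: field_simps)
      hence "n \<le> m * b" by (metis of_nat_le_iff of_nat_mult)
      \<comment> \<open>The number of padding variables is \<open>m * b - n\<close>.\<close>
      hence mb: "m * b = n + (m * b - n)" by simp
      have "b \<ge> 1" using \<open>n \<le> m * b\<close> n by (cases b) auto
      obtain t where t: "covered_by n M opn d f t" "t \<le> 64 * n * m * (2 ^ b + 1) + 49152 * n ^ 4"
        using covered_by_random_trees[OF n m(1) \<open>b \<ge> 1\<close> mb f, of d] m \<open>m \<ge> 2\<close> by auto
      have "real t \<le> real (64 * n * m * (2 ^ b + 1) + 49152 * n ^ 4)" using t(2) of_nat_mono by blast
      also have "\<dots> = 64 * real n * real m * (2 ^ b + 1) + 49152 * real n ^ 4"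
        by (simp add: distrib_left)
      also have "\<dots> \<le> 49152 * real n * real d * (2 ^ b + 1) + 49152 * real n powr 49152"
      proof (intro add_mono mult_mono)
        have "real n ^ 4 = real n powr 4" using n by (simp add: powr_numeral)
        also have "\<dots> \<le> real n powr 49152" using n by (intro powr_mono) auto
        finally show "real n ^ 4 \<le> real n powr 49152" .
      qed (use m in auto)
      finally show ?thesis using t(1) by blast
    qed
  qed
  then obtain t where t: "covered_by n M opn d f t"
    "real t \<le> 49152 * real n * real d * (2 ^ b + 1) + 49152 * real n powr 49152" by blast
  have "ereal_of_enat (depth_distance n M opn d f) \<le> ereal_of_enat (enat t)"
    using covered_by_imp_le[OF t(1)] by (simp only: ereal_of_enat_le_iff)
  also have "\<dots> \<le> ereal (49152 * real n * real d *
                  (2 powr real_of_int \<lceil>real n / real_of_int \<lfloor>real d / 8\<rfloor>\<rceil> + 1)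
                + 2 powr (49152 * real n powr (1 / real d))
                + 49152 * real n powr 49152)"
    unfolding exponent ereal_of_enat_simps ereal_less_eq by (rule order_trans[OF t(2)]) simp
  finally show "ereal_of_enat (depth_distance n M opn d f) \<le>
         ereal (49152 * real n * real d *
                  (2 powr real_of_int \<lceil>real n / real_of_int \<lfloor>real d / 8\<rfloor>\<rceil> + 1)
                + 2 powr (49152 * real n powr (1 / real d))
                + 49152 * real n powr 49152)" .
qed auto

end
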